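(* Let $M=(S,A,P,R,\gamma,\rho)$ be a Markov decision process with finite state space $S$ and discount factor $\gamma\in[0,1)$, let $\pi$ be a target policy with value function $V^\pi$ and $\mu$ a behavior policy, let $d_\mu$ be the stationary distribution over states induced by $\mu$, and let $f\in\mathbb{R}^{|S|}$ be defined by $f^\top = d_\mu^\top (I-\gamma P_\pi)^{-1}$, where $f>0$ element-wise. Let $T^\pi v = R_\pi+\gamma P_\pi v$ be the Bellman operator of $\pi$, let $\Pi_f$ be the projection onto the linear subspace of $\mathbb{R}^{|S|}$ spanned by the features with respect to the $f$-weighted Euclidean norm, and let $\kappa=\min_{s\in S}\frac{d_\mu(s)}{f(s)}$. Let $\theta^*\in\mathbb{R}^n$ be a solution of the projected fixed-point equation $\Phi^\top\theta=\Pi_f T^\pi(\Phi^\top\theta)$. Then $$\|\Phi^\top\theta^*-V^\pi\|_f\le\frac{1}{1-\sqrt{\gamma(1-\kappa)}}\,\|\Pi_f V^\pi-V^\pi\|_f .$$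
   Context: In $M=(S,A,P,R,\gamma,\rho)$, $S$ is the state space, $A$ the action space, $P$ the transition probabilities, $R$ the reward function, $\gamma$ the discount factor and $\rho$ the initial state distribution. A policy $\pi$ assigns to each state $s$ a probability distribution $\pi(\cdot|s)$ on $A$. The value function is $V^\pi(s)=\mathbb{E}^\pi\big[\sum_{t=0}^\infty\gamma^t R(s_t,a_t)\,\big|\,s_0=s\big]$, where $a_t\sim\pi(\cdot|s_t)$ and $s_{t+1}\sim P(\cdot|s_t,a_t)$. The matrix $P_\pi\in\mathbb{R}^{|S|\times|S|}$, with entries $P_\pi(s'|s)=\sum_a\pi(a|s)P(s'|s,a)$ (row $s$, column $s'$), and the vector $R_\pi\in\mathbb{R}^{|S|}$, with entries $R_\pi(s)=\sum_a\pi(a|s)R(s,a)$, are the (row-stochastic) transition matrix and reward vector induced by $\pi$; $P_\mu$ is defined likewise. The stationary distribution $d_\mu$ is a probability vector with $d_\mu^\top P_\mu=d_\mu^\top$. The behavior policy generates samples by $a_t\sim\mu(\cdot|s_t)$, $s_{t+1}\sim P(\cdot|s_t,a_t)$, and the ratios $\pi(a_t|s_t)/\mu(a_t|s_t)$ are assumed to be well-defined for all $t$. Each state $s$ has a feature vector $\phi(s)\in\mathbb{R}^n$, and $\Phi\in\mathbb{R}^{n\times|S|}$ is the matrix whose columns are the feature vectors of all states. The subspace spanned by the features is $\{\Phi^\top\theta:\theta\in\mathbb{R}^n\}\subseteq\mathbb{R}^{|S|}$. For $d\in\mathbb{R}^{|S|}$ with $d>0$ element-wise, the $d$-weighted Euclidean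 norm is $\|v\|_d=\big(\sum_s d(s)v(s)^2\big)^{1/2}$, and $\Pi_d$ is the orthogonal projection onto that subspace with respect to this norm (i.e. $\Pi_d v$ is the minimizer of $\|u-v\|_d$ over $u$ in the subspace). *)

theory Defs
  imports "HOL-Probability.Probability"
begin

text \<open>
  The state space is the finite type \<open>'s\<close>. The action type \<open>'a\<close> is arbitrary; policies are
  discrete distributions on it.
\<close>

record ('s, 'a) mdp =
  trans_prob :: "'s \<Rightarrow> 'a \<Rightarrow> 's pmf"
  reward :: "'s \<Rightarrow> 'a \<Rightarrow> real"
  discount :: real
  init :: "'s pmf"

type_synonym ('s, 'a) policy = "'s \<Rightarrow> 'a pmf"

text \<open>
  Law of \<open>(s\<^sub>t, a\<^sub>t)\<close> given the earlier state-action pairs, where \<open>s\<^sub>0\<close> has law \<open>\<nu>\<close>.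
\<close>

definition step_pmf ::
  "('s, 'a) mdp \<Rightarrow> ('s, 'a) policy \<Rightarrow> 's pmf \<Rightarrow> nat \<Rightarrow> (nat \<Rightarrow> 's \<times> 'a) \<Rightarrow> ('s \<times> 'a) pmf" where
  "step_pmf M \<pi> \<nu> t \<omega> =
    (case t of 0 \<Rightarrow> \<nu> | Suc k \<Rightarrow> trans_prob M (fst (\<omega> k)) (snd (\<omega> k)))
      \<bind> (\<lambda>s. map_pmf (Pair s) (\<pi> s))"

lemma Ionescu_Tulcea_step_pmf:
  "Ionescu_Tulcea (\<lambda>t \<omega>. measure_pmf (step_pmf M \<pi> \<nu> t \<omega>)) (\<lambda>_. count_space UNIV)"
proof (rule Ionescu_Tulcea.intro)
  fix t
  show "(\<lambda>\<omega>. measure_pmf (step_pmf M \<pi> \<nu> t \<omega>))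
    \<in> measurable (PiM {0..<t} (\<lambda>_. count_space UNIV)) (subprob_algebra (count_space UNIV))"
  proof (cases t)
    case 0
    then show ?thesis
      by (simp add: step_pmf_def measure_pmf_in_subprob_algebra)
  next
    case (Suc k)
    define g where
      "g x = measure_pmf (trans_prob M (fst x) (snd x) \<bind> (\<lambda>s. map_pmf (Pair s) (\<pi> s)))" for x
    have "g \<in> measurable (count_space UNIV) (subprob_algebra (count_space UNIV))"
      by (auto simp: g_def measure_pmf_in_subprob_algebra)
    moreover have "(\<lambda>\<omega>. \<omega> k)
      \<in> measurable (PiM {0..<t} (\<lambda>_. count_space UNIV)) (count_space (UNIV :: ('a \<times> 'b) set))"
      by (rule measurable_component_singleton) (simp add: Suc)
    ultimately have "(\<lambda>\<omega>. g (\<omega> k))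
      \<in> measurable (PiM {0..<t} (\<lambda>_. count_space UNIV)) (subprob_algebra (count_space UNIV))"
      by (rule measurable_compose[rotated])
    then show ?thesis
      by (simp add: Suc g_def step_pmf_def)
  qed
qed (simp add: prob_space_measure_pmf)

text \<open>
  The law of the whole trajectory \<open>(s\<^sub>t, a\<^sub>t)\<^sub>t\<close>: the infinite product measure that the
  Ionescu-Tulcea theorem builds from these kernels.
\<close>

definition trajectory ::
  "('s, 'a) mdp \<Rightarrow> ('s, 'a) policy \<Rightarrow> 's pmf \<Rightarrow> (nat \<Rightarrow> 's \<times> 'a) measure" where
  "trajectory M \<pi> \<nu> =
    projective_family.lim UNIV
      (Ionescu_Tulcea.CI (\<lambda>t \<omega>. measure_pmf (step_pmf M \<pi> \<nu> t \<omega>)) (\<lambda>_. count_space UNIV))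
      (\<lambda>_. count_space UNIV)"

definition value_fun :: "('s::finite, 'a) mdp \<Rightarrow> ('s, 'a) policy \<Rightarrow> real ^ 's" where
  "value_fun M \<pi> =
    (\<chi> s. \<integral>\<omega>. (\<Sum>t. discount M ^ t * reward M (fst (\<omega> t)) (snd (\<omega> t)))
           \<partial>trajectory M \<pi> (return_pmf s))"

definition trans_matrix :: "('s::finite, 'a) mdp \<Rightarrow> ('s, 'a) policy \<Rightarrow> real ^ 's ^ 's" where
  "trans_matrix M \<pi> = (\<chi> s s'. \<Sum>\<^sub>\<infinity>a. pmf (\<pi> s) a * pmf (trans_prob M s a) s')"

definition reward_vec :: "('s::finite, 'a) mdp \<Rightarrow> ('s, 'a) policy \<Rightarrow> real ^ 's" where
  "reward_vec M \<pi> = (\<chi> s. \<Sum>\<^sub>\<infinity>a. pmf (\<pi> s) a * reward M s a)"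

text \<open>
  Convergence of the series defining \<open>reward_vec\<close>; automatic if there are finitely many actions.
\<close>

definition reward_summable :: "('s, 'a) mdp \<Rightarrow> ('s, 'a) policy \<Rightarrow> bool" where
  "reward_summable M \<pi> \<longleftrightarrow> (\<forall>s. (\<lambda>a. pmf (\<pi> s) a * reward M s a) summable_on UNIV)"

definition bellman :: "('s::finite, 'a) mdp \<Rightarrow> ('s, 'a) policy \<Rightarrow> real ^ 's \<Rightarrow> real ^ 's" where
  "bellman M \<pi> v = reward_vec M \<pi> + discount M *\<^sub>R (trans_matrix M \<pi> *v v)"

definition stationary :: "('s::finite, 'a) mdp \<Rightarrow> ('s, 'a) policy \<Rightarrow> real ^ 's \<Rightarrow> bool" where
  "stationary M \<mu> d \<longleftrightarrow>
    (\<forall>s. 0 \<le> d $ s) \<and> (\<Sum>s\<in>UNIV. d $ s) = 1 \<and> d v* trans_matrix M \<mu> = d"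

text \<open>
  Well-definedness of the ratios \<open>\<pi>(a|s\<^sub>t) / \<mu>(a|s\<^sub>t)\<close> at every time along the behavior
  trajectory. Stated for all actions \<open>a\<close> that \<open>\<pi>\<close> may take in \<open>s\<^sub>t\<close>, since for \<open>a = a\<^sub>t\<close> alone the
  denominator is almost surely nonzero anyway.
\<close>

definition ratios_well_defined ::
  "('s, 'a) mdp \<Rightarrow> ('s, 'a) policy \<Rightarrow> ('s, 'a) policy \<Rightarrow> bool" where
  "ratios_well_defined M \<pi> \<mu> \<longleftrightarrow>
    (AE \<omega> in trajectory M \<mu> (init M).
      \<forall>t a. pmf (\<pi> (fst (\<omega> t))) a \<noteq> 0 \<longrightarrow> pmf (\<mu> (fst (\<omega> t))) a \<noteq> 0)"

definition emphasis ::
  "('s::finite, 'a) mdp \<Rightarrow> ('s, 'a) policy \<Rightarrow> real ^ 's \<Rightarrow> real ^ 's" where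
  "emphasis M \<pi> d = d v* matrix_inv (mat 1 - discount M *\<^sub>R trans_matrix M \<pi>)"

definition feature_matrix :: "('s::finite \<Rightarrow> real ^ 'n::finite) \<Rightarrow> real ^ 's ^ 'n" where
  "feature_matrix \<phi> = (\<chi> i s. \<phi> s $ i)"

definition feature_space :: "real ^ 's::finite ^ 'n::finite \<Rightarrow> (real ^ 's) set" where
  "feature_space \<Phi> = range (\<lambda>\<theta>. transpose \<Phi> *v \<theta>)"

definition wnorm :: "real ^ 's::finite \<Rightarrow> real ^ 's \<Rightarrow> real" where
  "wnorm d v = sqrt (\<Sum>s\<in>UNIV. d $ s * (v $ s)\<^sup>2)"

text \<open>The minimizer exists and is unique when \<open>d > 0\<close> and \<open>U\<close> is a subspace.\<close>

definition wproj :: "real ^ 's::finite \<Rightarrow> (real ^ 's) set \<Rightarrow> real ^ 's \<Rightarrow> real ^ 's" where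
  "wproj d U v = (ARG_MIN (\<lambda>u. wnorm d (u - v)) u. u \<in> U)"

end

theory Submission
  imports Defs
begin

text \<open>
  The balance equation \<open>\<gamma> f\<^sup>T P\<^sub>\<pi> = f\<^sup>T - d\<^sup>T\<close> and Jensen's inequality for the rows of \<open>P\<^sub>\<pi>\<close> give
  \<open>\<parallel>\<gamma> P\<^sub>\<pi> v\<parallel>\<^sup>2 \<le> \<gamma> \<Sum>\<^sub>s (f s - d s) (v s)\<^sup>2 \<le> \<gamma> (1 - \<kappa>) \<parallel>v\<parallel>\<^sup>2\<close> in the \<open>f\<close>-weighted norm, so the Bellman
  operator contracts with factor \<open>\<beta> = sqrt (\<gamma> (1 - \<kappa>)) < 1\<close>. Its fixed point is the value function:
  the law of \<open>(s\<^sub>t, a\<^sub>t)\<close> is a coordinate marginal of the Ionescu-Tulcea measure, which yields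
  \<open>V = \<Sum>\<^sub>t \<gamma>\<^sup>t P\<^sub>\<pi>\<^sup>t R\<^sub>\<pi>\<close>. The projection is nonexpansive, hence
  \<open>\<parallel>\<Phi>\<^sup>T\<theta> - V\<parallel> \<le> \<beta> \<parallel>\<Phi>\<^sup>T\<theta> - V\<parallel> + \<parallel>\<Pi> V - V\<parallel>\<close>.
\<close>

section \<open>Expectations along a trajectory\<close>

lemma integrable_measure_pmf_iff:
  fixes g :: "'b \<Rightarrow> real"
  shows "integrable (measure_pmf p) g \<longleftrightarrow> integrable (count_space UNIV) (\<lambda>x. pmf p x * g x)"
  unfolding measure_pmf_eq_density by (subst integrable_density) simp_all

lemma integral_measure_pmf_count_space:
  fixes g :: "'b \<Rightarrow> real"
  shows "measure_pmf.expectation p g = (\<integral>x. pmf p x * g x \<partial>count_space UNIV)"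
  unfolding measure_pmf_eq_density by (subst integral_density) simp_all

text \<open>For real terms unconditional and absolute summability coincide, and the latter is
  integrability against counting measure. This makes \<open>reward_summable\<close> usable as
  integrability of the reward under \<open>\<pi> s\<close>.\<close>

lemma summable_on_pmf_iff_integrable:
  fixes g :: "'b \<Rightarrow> real"
  shows "(\<lambda>x. pmf p x * g x) summable_on UNIV \<longleftrightarrow> integrable (measure_pmf p) g"
  by (subst summable_on_iff_abs_summable_on_real)
    (simp only: abs_summable_equivalent abs_summable_on_def integrable_measure_pmf_iff)

lemma infsum_pmf_eq_expectation:
  fixes g :: "'b \<Rightarrow> real"
  assumes "integrable (measure_pmf p) g"
  shows "(\<Sum>\<^sub>\<infinity>x. pmf p x * g x) = measure_pmf.expectation p g"
proof -
  have "Infinite_Set_Sum.abs_summable_on (\<lambda>x. pmf p x * g x) UNIV"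
    using assms unfolding integrable_measure_pmf_iff abs_summable_on_def .
  then show ?thesis
    by (simp add: infsetsum_infsum[symmetric] infsetsum_def integral_measure_pmf_count_space)
qed

text \<open>A mixture over finitely many states is a finite sum of densities, so integrability of
  each component passes to the mixture even for unbounded \<open>g\<close>.\<close>

lemma bind_pmf_finite_integral:
  fixes p :: "'s::finite pmf" and q :: "'s \<Rightarrow> 'b pmf" and g :: "'b \<Rightarrow> real"
  assumes "\<And>s. integrable (measure_pmf (q s)) g"
  shows integrable_bind_pmf_finite: "integrable (measure_pmf (p \<bind> q)) g"
    and integral_bind_pmf_finite: "measure_pmf.expectation (p \<bind> q) g =
      (\<Sum>s\<in>UNIV. pmf p s * measure_pmf.expectation (q s) g)"
proof -
  have eq: "pmf (p \<bind> q) x * g x = (\<Sum>s\<in>UNIV. pmf p s * (pmf (q s) x * g x))" for x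
    by (simp add: pmf_bind integral_measure_pmf_real[where A = UNIV] sum_distrib_left
        sum_distrib_right mult_ac)
  have int: "integrable (count_space UNIV) (\<lambda>x. pmf p s * (pmf (q s) x * g x))" for s
    using assms[of s] by (simp add: integrable_measure_pmf_iff)
  show "integrable (measure_pmf (p \<bind> q)) g"
    unfolding integrable_measure_pmf_iff eq using int by (intro Bochner_Integration.integrable_sum)
  show "measure_pmf.expectation (p \<bind> q) g =
      (\<Sum>s\<in>UNIV. pmf p s * measure_pmf.expectation (q s) g)"
    unfolding integral_measure_pmf_count_space eq
    using int by (subst Bochner_Integration.integral_sum) auto
qed

section \<open>The state chain and the coordinate marginals of the trajectory measure\<close>

definition state_step :: "('s, 'a) mdp \<Rightarrow> ('s, 'a) policy \<Rightarrow> 's \<Rightarrow> 's pmf" where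
  "state_step M \<pi> s = \<pi> s \<bind> trans_prob M s"

definition state_law :: "('s, 'a) mdp \<Rightarrow> ('s, 'a) policy \<Rightarrow> 's pmf \<Rightarrow> nat \<Rightarrow> 's pmf" where
  "state_law M \<pi> \<nu> t = ((\<lambda>p. p \<bind> state_step M \<pi>) ^^ t) \<nu>"

definition with_action :: "('s, 'a) policy \<Rightarrow> 's pmf \<Rightarrow> ('s \<times> 'a) pmf" where
  "with_action \<pi> p = p \<bind> (\<lambda>s. map_pmf (Pair s) (\<pi> s))"

text \<open>One step of the chain of state-action pairs projects to one step of the chain of states;
  this closes the induction over time in \<open>distr_C_coordinate\<close>.\<close>

lemma with_action_state_step:
  "with_action \<pi> p \<bind> (\<lambda>x. with_action \<pi> (trans_prob M (fst x) (snd x))) =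
    with_action \<pi> (p \<bind> state_step M \<pi>)"
  by (simp add: with_action_def state_step_def bind_assoc_pmf bind_map_pmf)

context
  fixes M :: "('s, 'a) mdp" and \<pi> :: "('s, 'a) policy" and \<nu> :: "'s pmf"
begin

interpretation IT: Ionescu_Tulcea "\<lambda>t \<omega>. measure_pmf (step_pmf M \<pi> \<nu> t \<omega>)" "\<lambda>_. count_space UNIV"
  by (rule Ionescu_Tulcea_step_pmf)

lemma sets_trajectory [measurable_cong]:
  "sets (trajectory M \<pi> \<nu>) = sets (PiM UNIV (\<lambda>_. count_space UNIV))"
  by (simp add: trajectory_def)

lemma measurable_trajectory_coordinate [measurable]:
  "(\<lambda>\<omega>. \<omega> t) \<in> measurable (trajectory M \<pi> \<nu>) (count_space UNIV)"
  unfolding measurable_cong_sets[OF sets_trajectory refl]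
  by (rule measurable_component_singleton) simp

text \<open>Coordinate \<open>t\<close> only sees the first \<open>Suc t\<close> coordinates, and on
  these the projective limit agrees with the finite composition \<open>IT.C\<close> of
  kernels.\<close>

lemma distr_trajectory_eq_C:
  "distr (trajectory M \<pi> \<nu>) (count_space UNIV) (\<lambda>\<omega>. \<omega> t) =
    distr (IT.C 0 (Suc t) (\<lambda>_. undefined)) (count_space UNIV) (\<lambda>\<omega>. \<omega> t)"
proof -
  let ?N = "count_space UNIV :: ('s \<times> 'a) measure" and ?J = "{0..<Suc t}"
  \<comment> \<open>\<open>IT.CI ?J\<close> is defined through the composition up to
    \<open>IT.up_to ?J\<close>, the least bound above all indices in \<open>?J\<close>.\<close>
  have up: "IT.up_to ?J = Suc t"
    by (rule antisym) (auto simp: IT.up_to_iff_Ico not_less_eq_eq[symmetric]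
        dest: IT.up_to_less[rotated, of t ?J])
  have coord: "(\<lambda>\<omega>. \<omega> t) \<in> measurable (PiM ?J (\<lambda>_. ?N)) ?N"
    by (rule measurable_component_singleton) simp
  have "distr (trajectory M \<pi> \<nu>) ?N (\<lambda>\<omega>. \<omega> t) =
      distr (distr (trajectory M \<pi> \<nu>) (PiM ?J (\<lambda>_. ?N)) (\<lambda>\<omega>. restrict \<omega> ?J)) ?N (\<lambda>\<omega>. \<omega> t)"
    by (subst distr_distr[OF coord])
      (auto simp: comp_def measurable_cong_sets[OF sets_trajectory refl]
        intro!: measurable_restrict_subset)
  also have "\<dots> = distr (IT.CI ?J) ?N (\<lambda>\<omega>. \<omega> t)"
    unfolding trajectory_def by (subst IT.distr_lim) auto
  also have "\<dots> = distr (IT.C 0 (Suc t) (\<lambda>_. undefined)) ?N (\<lambda>\<omega>. \<omega> t)"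
    unfolding IT.CI_def up
    by (subst distr_distr[OF coord])
      (auto simp: comp_def measurable_cong_sets[OF IT.sets_C refl] simp del: IT.C.simps
        intro!: measurable_restrict_subset)
  finally show ?thesis .
qed

text \<open>Markov property: from time 1 on, the kernel reads only the previous coordinate, so the
  law of each pair is determined by the law of the one before.\<close>

lemma distr_C_coordinate:
  "distr (IT.C 0 (Suc t) (\<lambda>_. undefined)) (count_space UNIV) (\<lambda>\<omega>. \<omega> t) =
    measure_pmf (with_action \<pi> (state_law M \<pi> \<nu> t))"
proof -
  let ?N = "count_space UNIV :: ('s \<times> 'a) measure"
  let ?C = "\<lambda>t. IT.C 0 t (\<lambda>_. undefined)"
  have ne: "space (?C t) \<noteq> {}" for t
    by (subst IT.space_C) (auto simp: space_PiM)
  have sC: "sets (?C t) = sets (PiM {0..<t} (\<lambda>_. ?N))" for t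
    by (subst IT.sets_C) (auto simp: space_PiM)
  have step: "distr (?C (Suc t)) ?N (\<lambda>\<omega>. \<omega> t) = ?C t \<bind> (\<lambda>\<omega>. measure_pmf (step_pmf M \<pi> \<nu> t \<omega>))" for t
  proof -
    have coord: "(\<lambda>\<omega>. \<omega> t) \<in> measurable (PiM {0..<Suc t} (\<lambda>_. ?N)) ?N"
      by (rule measurable_component_singleton) simp
    have eP: "IT.eP t \<in> measurable (?C t) (subprob_algebra (PiM {0..<Suc t} (\<lambda>_. ?N)))"
      unfolding measurable_cong_sets[OF sC refl] by (rule IT.measurable_eP)
    have "distr (?C (Suc t)) ?N (\<lambda>\<omega>. \<omega> t) = distr (?C t \<bind> IT.eP t) ?N (\<lambda>\<omega>. \<omega> t)"
      by simp
    also have "\<dots> = ?C t \<bind> (\<lambda>\<omega>. distr (IT.eP t \<omega>) ?N (\<lambda>\<omega>. \<omega> t))"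
      by (rule distr_bind[OF eP ne coord])
    also have "\<dots> = ?C t \<bind> (\<lambda>\<omega>. measure_pmf (step_pmf M \<pi> \<nu> t \<omega>))"
    proof (rule bind_cong[OF refl])
      fix \<omega> assume "\<omega> \<in> space (?C t)"
      then have \<omega>: "\<omega> \<in> space (PiM {0..<t} (\<lambda>_. ?N))"
        using sets_eq_imp_space_eq[OF sC] by simp
      \<comment> \<open>\<open>IT.eP t \<omega>\<close> pushes the kernel forward along writing
        coordinate \<open>t\<close> into the history; reading that coordinate back returns the
        kernel. The source is discrete, so only membership in the product space needs
        checking.\<close>
      have upd: "fun_upd \<omega> t \<in> measurable (measure_pmf (step_pmf M \<pi> \<nu> t \<omega>)) (PiM {0..<Suc t} (\<lambda>_. ?N))"
        using \<omega> by (auto simp: space_PiM PiE_iff extensional_def)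
      show "distr (IT.eP t \<omega>) ?N (\<lambda>\<omega>. \<omega> t) = measure_pmf (step_pmf M \<pi> \<nu> t \<omega>)"
        unfolding IT.eP_def distr_distr[OF coord upd]
        by (simp add: comp_def distr_id2)
    qed
    finally show ?thesis .
  qed
  show ?thesis
  proof (induction t)
    case 0
    have start: "step_pmf M \<pi> \<nu> 0 \<omega> = with_action \<pi> (state_law M \<pi> \<nu> 0)" for \<omega>
      by (simp add: step_pmf_def with_action_def state_law_def)
    have "prob_space (?C 0)"
      by (rule IT.prob_space_C) (simp add: space_PiM)
    then show ?case
      \<comment> \<open>The kernel at time 0 ignores the history, so binding it to the probability
        measure \<open>?C 0\<close> leaves it unchanged.\<close>
      unfolding step start
      by (intro bind_const' prob_space_imp_subprob_space prob_space_measure_pmf)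
  next
    case (Suc t)
    define K where "K = (\<lambda>x. with_action \<pi> (trans_prob M (fst x) (snd x)))"
    have kernel: "step_pmf M \<pi> \<nu> (Suc t) \<omega> = K (\<omega> t)" for \<omega>
      by (simp add: step_pmf_def K_def with_action_def)
    have coord: "(\<lambda>\<omega>. \<omega> t) \<in> measurable (?C (Suc t)) ?N"
      unfolding measurable_cong_sets[OF sC refl] by (rule measurable_component_singleton) simp
    have K: "(\<lambda>x. measure_pmf (K x)) \<in> measurable ?N (subprob_algebra ?N)"
      by (simp add: measure_pmf_in_subprob_algebra)
    have "distr (?C (Suc (Suc t))) ?N (\<lambda>\<omega>. \<omega> (Suc t)) = ?C (Suc t) \<bind> (\<lambda>\<omega>. measure_pmf (K (\<omega> t)))"
      unfolding step kernel ..
    also have "\<dots> = distr (?C (Suc t)) ?N (\<lambda>\<omega>. \<omega> t) \<bind> (\<lambda>x. measure_pmf (K x))"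
      by (rule bind_distr[OF coord K ne, symmetric])
    also have "\<dots> = measure_pmf (with_action \<pi> (state_law M \<pi> \<nu> t) \<bind> K)"
      unfolding Suc.IH measure_pmf_bind ..
    also have "with_action \<pi> (state_law M \<pi> \<nu> t) \<bind> K = with_action \<pi> (state_law M \<pi> \<nu> (Suc t))"
      unfolding K_def with_action_state_step by (simp add: state_law_def)
    finally show ?case .
  qed
qed

lemma distr_trajectory_coordinate:
  "distr (trajectory M \<pi> \<nu>) (count_space UNIV) (\<lambda>\<omega>. \<omega> t) =
    measure_pmf (with_action \<pi> (state_law M \<pi> \<nu> t))"
  using distr_trajectory_eq_C distr_C_coordinate by simp

end

section \<open>The Bellman equation for the value function\<close>

text \<open>Transition probabilities are at most 1, hence integrable over actions, so the infinite
  sum in \<open>trans_matrix\<close> is a genuine expectation. Stochasticity of the rows follows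
  from this form.\<close>

lemma trans_matrix_nth:
  fixes M :: "('s::finite, 'a) mdp"
  shows "trans_matrix M \<pi> $ s $ s' = pmf (state_step M \<pi> s) s'"
proof -
  have "integrable (measure_pmf (\<pi> s)) (\<lambda>a. pmf (trans_prob M s a) s')"
    by (rule measure_pmf.integrable_const_bound[where B = 1]) (auto simp: pmf_le_1)
  then show ?thesis
    by (simp add: trans_matrix_def state_step_def pmf_bind infsum_pmf_eq_expectation)
qed

lemma trans_matrix_nonneg:
  fixes M :: "('s::finite, 'a) mdp"
  shows "0 \<le> trans_matrix M \<pi> $ s $ s'"
  by (simp add: trans_matrix_nth)

lemma trans_matrix_row_sum:
  fixes M :: "('s::finite, 'a) mdp"
  shows "(\<Sum>s'\<in>UNIV. trans_matrix M \<pi> $ s $ s') = 1"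
  by (simp add: trans_matrix_nth sum_pmf_eq_1)

text \<open>Each row averages, so the matrix does not increase the sup norm. Used to dominate the
  value series and to show that the discounted matrix has trivial kernel.\<close>

lemma trans_matrix_mult_bound:
  fixes M :: "('s::finite, 'a) mdp"
  assumes "\<And>s. \<bar>v $ s\<bar> \<le> C"
  shows "\<bar>(trans_matrix M \<pi> *v v) $ s\<bar> \<le> C"
proof -
  have "\<bar>(trans_matrix M \<pi> *v v) $ s\<bar> \<le> (\<Sum>s'\<in>UNIV. trans_matrix M \<pi> $ s $ s' * C)"
    unfolding matrix_vector_mult_def vec_lambda_beta
    using assms by (intro order_trans[OF sum_abs] sum_mono)
      (simp add: abs_mult trans_matrix_nonneg mult_left_mono)
  also have "\<dots> = C"
    by (simp flip: sum_distrib_right add: trans_matrix_row_sum)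
  finally show ?thesis .
qed

text \<open>Duality between moving the law forward and applying the matrix to a function.
  \<open>w\<close> is left arbitrary because the induction step moves one matrix factor onto
  it.\<close>

lemma sum_state_law:
  fixes M :: "('s::finite, 'a) mdp" and w :: "real ^ 's"
  shows "(\<Sum>s\<in>UNIV. pmf (state_law M \<pi> \<nu> t) s * w $ s) =
    (\<Sum>s\<in>UNIV. pmf \<nu> s * (((*v) (trans_matrix M \<pi>) ^^ t) w) $ s)"
proof (induction t arbitrary: w)
  case 0
  show ?case by (simp add: state_law_def)
next
  case (Suc t)
  let ?p = "state_law M \<pi> \<nu> t"
  have "(\<Sum>s\<in>UNIV. pmf (state_law M \<pi> \<nu> (Suc t)) s * w $ s) =
      (\<Sum>s'\<in>UNIV. \<Sum>s\<in>UNIV. pmf ?p s * (trans_matrix M \<pi> $ s $ s' * w $ s'))"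
    by (simp add: state_law_def pmf_bind integral_measure_pmf_real[where A = UNIV]
        trans_matrix_nth sum_distrib_left mult_ac)
  also have "\<dots> = (\<Sum>s\<in>UNIV. pmf ?p s * (trans_matrix M \<pi> *v w) $ s)"
    by (subst sum.swap) (simp add: matrix_vector_mult_def sum_distrib_left)
  also have "\<dots> = (\<Sum>s\<in>UNIV. pmf \<nu> s * (((*v) (trans_matrix M \<pi>) ^^ Suc t) w) $ s)"
    unfolding Suc.IH by (simp add: funpow_swap1)
  finally show ?case .
qed

text \<open>Integrates against the marginal at time \<open>t\<close> and then moves the time
  evolution onto the expected value of \<open>g\<close> by duality. It is applied both to the reward
  and to its absolute value.\<close>

lemma trajectory_expectation:
  fixes M :: "('s::finite, 'a) mdp" and g :: "'s \<Rightarrow> 'a \<Rightarrow> real"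
  assumes int: "\<And>s. integrable (measure_pmf (\<pi> s)) (g s)"
  shows integrable_trajectory:
      "integrable (trajectory M \<pi> (return_pmf s)) (\<lambda>\<omega>. g (fst (\<omega> t)) (snd (\<omega> t)))"
    and integral_trajectory:
      "(\<integral>\<omega>. g (fst (\<omega> t)) (snd (\<omega> t)) \<partial>trajectory M \<pi> (return_pmf s)) =
        (((*v) (trans_matrix M \<pi>) ^^ t) (\<chi> s. measure_pmf.expectation (\<pi> s) (g s))) $ s"
proof -
  let ?T = "trajectory M \<pi> (return_pmf s)" and ?p = "state_law M \<pi> (return_pmf s) t"
  let ?g = "\<lambda>x. g (fst x) (snd x)"
  let ?w = "\<chi> s. measure_pmf.expectation (\<pi> s) (g s)"
  have "integrable (measure_pmf (with_action \<pi> ?p)) ?g"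
    unfolding with_action_def using int by (intro integrable_bind_pmf_finite) simp
  then have "integrable (distr ?T (count_space UNIV) (\<lambda>\<omega>. \<omega> t)) ?g"
    by (simp add: distr_trajectory_coordinate)
  then show "integrable ?T (\<lambda>\<omega>. ?g (\<omega> t))"
    by (subst (asm) integrable_distr_eq) (auto intro: measurable_trajectory_coordinate)
  have "(\<integral>\<omega>. ?g (\<omega> t) \<partial>?T) = (\<integral>x. ?g x \<partial>distr ?T (count_space UNIV) (\<lambda>\<omega>. \<omega> t))"
    by (subst integral_distr) (auto intro: measurable_trajectory_coordinate)
  also have "\<dots> = measure_pmf.expectation (with_action \<pi> ?p) ?g"
    by (simp add: distr_trajectory_coordinate)
  also have "\<dots> = (\<Sum>s\<in>UNIV. pmf ?p s * ?w $ s)"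
    unfolding with_action_def using int by (subst integral_bind_pmf_finite) auto
  also have "\<dots> = (((*v) (trans_matrix M \<pi>) ^^ t) ?w) $ s"
    unfolding sum_state_law by (simp add: indicator_def if_distrib cong: if_cong)
  finally show "(\<integral>\<omega>. ?g (\<omega> t) \<partial>?T) = (((*v) (trans_matrix M \<pi>) ^^ t) ?w) $ s" .
qed

text \<open>Expectation and discounted sum are interchanged: the L1 norms of the terms are dominated
  by a geometric series.\<close>

lemma value_fun_sums:
  fixes M :: "('s::finite, 'a) mdp"
  assumes \<gamma>: "0 \<le> discount M" "discount M < 1" and "reward_summable M \<pi>"
  shows "(\<lambda>t. discount M ^ t *\<^sub>R ((*v) (trans_matrix M \<pi>) ^^ t) (reward_vec M \<pi>)) sums value_fun M \<pi>"
proof -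
  let ?A = "\<lambda>t. ((*v) (trans_matrix M \<pi>) ^^ t)"
  have int: "integrable (measure_pmf (\<pi> s)) (reward M s)" for s
    using assms(3) by (simp add: reward_summable_def summable_on_pmf_iff_integrable)
  have R: "reward_vec M \<pi> = (\<chi> s. measure_pmf.expectation (\<pi> s) (reward M s))"
    using int by (simp add: reward_vec_def infsum_pmf_eq_expectation)
  \<comment> \<open>The expected absolute reward per state. Rewards may be unbounded over actions,
    but \<open>w\<close> has finitely many entries, so the bound \<open>C\<close> exists and
    survives every power of the matrix.\<close>
  define w :: "real ^ 's" where "w = (\<chi> s. measure_pmf.expectation (\<pi> s) (\<lambda>a. \<bar>reward M s a\<bar>))"
  define C where "C = Max (range (\<lambda>s. \<bar>w $ s\<bar>))"
  have C: "\<bar>w $ s\<bar> \<le> C" for s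
    by (simp add: C_def)
  have AC: "\<bar>(?A t w) $ s\<bar> \<le> C" for t s
    by (induction t arbitrary: s) (simp_all add: C trans_matrix_mult_bound)
  have "(\<lambda>t. discount M ^ t * (?A t (reward_vec M \<pi>)) $ s) sums value_fun M \<pi> $ s" for s
  proof -
    let ?T = "trajectory M \<pi> (return_pmf s)"
    let ?r = "\<lambda>t \<omega>. discount M ^ t * reward M (fst (\<omega> t)) (snd (\<omega> t))"
    note int_r = integrable_trajectory[of \<pi> "reward M", OF int]
    have rI: "integrable ?T (?r t)" for t
      using int_r by (rule integrable_mult_right)
    have norm_r: "(\<integral>\<omega>. norm (?r t \<omega>) \<partial>?T) = discount M ^ t * (?A t w) $ s" for t
      using integral_trajectory[of \<pi> "\<lambda>s a. \<bar>reward M s a\<bar>" M s t] int \<gamma>(1)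
      by (simp add: abs_mult w_def)
    have summable: "summable (\<lambda>t. discount M ^ t * (?A t w) $ s)"
    proof (rule summable_comparison_test')
      show "summable (\<lambda>t. discount M ^ t * C)"
        using \<gamma> by (intro summable_mult2 summable_geometric) simp
      show "norm (discount M ^ t * (?A t w) $ s) \<le> discount M ^ t * C" if "0 \<le> t" for t
        using \<gamma>(1) AC by (simp add: abs_mult mult_left_mono)
    qed
    have meas: "(\<lambda>\<omega>. ennreal (norm (?r t \<omega>))) \<in> borel_measurable ?T" for t
      by (rule measurable_compose[OF borel_measurable_integrable[OF integrable_norm[OF rI]]
            measurable_ennreal])
    \<comment> \<open>Tonelli for the absolute terms: a finite integral of their sum forces absolute
      convergence along almost every trajectory, as \<open>sums_integral\<close> requires.\<close>
    have "(\<integral>\<^sup>+\<omega>. (\<Sum>t. ennreal (norm (?r t \<omega>))) \<partial>?T) = (\<Sum>t. \<integral>\<^sup>+\<omega>. ennreal (norm (?r t \<omega>)) \<partial>?T)"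
      by (rule nn_integral_suminf[OF meas])
    also have "\<dots> = (\<Sum>t. ennreal (discount M ^ t * (?A t w) $ s))"
      using rI by (intro suminf_cong)
        (simp only: nn_integral_eq_integral[OF integrable_norm] norm_r AE_I2 norm_ge_zero)
    also have "\<dots> \<noteq> \<infinity>"
    proof -
      have "0 \<le> discount M ^ t * (?A t w) $ s" for t
        unfolding norm_r[symmetric] by simp
      from ennreal_suminf_neq_top[OF summable this] show ?thesis
        unfolding infinity_ennreal_def .
    qed
    finally have "AE \<omega> in ?T. (\<Sum>t. ennreal (norm (?r t \<omega>))) \<noteq> \<infinity>"
      by (rule nn_integral_PInf_AE[OF borel_measurable_suminf_order[OF meas]])
    then have "AE \<omega> in ?T. summable (\<lambda>t. norm (?r t \<omega>))"
      unfolding infinity_ennreal_def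
      by (rule AE_mp) (blast intro: AE_I2 summable_suminf_not_top norm_ge_zero)
    from sums_integral[OF rI this] summable norm_r
    have "(\<lambda>t. integral\<^sup>L ?T (?r t)) sums (\<integral>\<omega>. (\<Sum>t. ?r t \<omega>) \<partial>?T)"
      by simp
    moreover have "integral\<^sup>L ?T (?r t) = discount M ^ t * (?A t (reward_vec M \<pi>)) $ s" for t
      using integral_trajectory[of \<pi> "reward M" M s t] int by (simp add: R)
    ultimately show ?thesis
      unfolding value_fun_def vec_lambda_beta by (simp only:)
  qed
  then show ?thesis
    unfolding sums_def by (intro vec_tendstoI) simp
qed

text \<open>Applying \<gamma> P to the series for the value function shifts it by one index; adding
  the term at index 0, which is \<open>reward_vec\<close>, restores it.\<close>

lemma bellman_value_fun:
  fixes M :: "('s::finite, 'a) mdp"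
  assumes "0 \<le> discount M" "discount M < 1" "reward_summable M \<pi>"
  shows "bellman M \<pi> (value_fun M \<pi>) = value_fun M \<pi>"
proof -
  let ?P = "trans_matrix M \<pi>"
  let ?u = "\<lambda>t. discount M ^ t *\<^sub>R ((*v) ?P ^^ t) (reward_vec M \<pi>)"
  have u: "?u sums value_fun M \<pi>"
    by (rule value_fun_sums[OF assms])
  have "(\<lambda>t. discount M *\<^sub>R (?P *v ?u t)) sums (discount M *\<^sub>R (?P *v value_fun M \<pi>))"
    using u by (intro sums_scaleR_right bounded_linear.sums[OF matrix_vector_mul_bounded_linear])
  then have "(\<lambda>t. ?u (Suc t)) sums (discount M *\<^sub>R (?P *v value_fun M \<pi>))"
    by (simp add: matrix_vector_mult_scaleR)
  then have "?u sums (discount M *\<^sub>R (?P *v value_fun M \<pi>) + ?u 0)"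
    by (rule sums_Suc)
  with u show ?thesis
    by (simp add: bellman_def sums_unique2 add.commute)
qed

section \<open>Weighted norms and projections\<close>

text \<open>
  Scaling by \<open>sqrt f\<close> is a linear isometry onto the Euclidean norm; it turns \<open>wproj\<close> into
  \<open>closest_point\<close>, whose Lipschitz bound is in the library.
\<close>

definition wscale :: "real ^ 's::finite \<Rightarrow> real ^ 's \<Rightarrow> real ^ 's" where
  "wscale f v = (\<chi> s. sqrt (f $ s) * v $ s)"

lemma linear_wscale: "linear (wscale f)"
  by (rule linearI) (simp_all add: wscale_def vec_eq_iff algebra_simps)

lemma wnorm_eq_norm:
  assumes "\<forall>s. 0 < f $ s"
  shows "wnorm f v = norm (wscale f v)"
proof -
  have "0 \<le> f $ s" for s
    using assms less_imp_le by blast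
  then show ?thesis
    by (simp add: wnorm_def wscale_def norm_vec_def L2_set_def power_mult_distrib)
qed

lemma wnorm_diff_eq_dist:
  assumes "\<forall>s. 0 < f $ s"
  shows "wnorm f (u - v) = dist (wscale f u) (wscale f v)"
  using assms by (simp add: wnorm_eq_norm linear_diff[OF linear_wscale] dist_norm)

lemma wscale_wproj:
  assumes f: "\<forall>s. 0 < f $ s" and U: "subspace U"
  shows "wscale f (wproj f U v) = closest_point (wscale f ` U) (wscale f v)"
proof -
  let ?S = "wscale f ` U"
  have S: "subspace ?S"
    using linear_wscale U by (rule linear_subspace_image)
  then have cl: "closed ?S" and ne: "?S \<noteq> {}"
    using closed_subspace subspace_0 by blast+
  obtain u where u: "u \<in> U" "closest_point ?S (wscale f v) = wscale f u"
    using closest_point_in_set[OF cl ne] by blast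
  \<comment> \<open>\<open>wproj\<close> is a Hilbert choice, so a minimiser must be exhibited
    before anything is known about the chosen one; uniqueness of the closest point in a convex set
    then identifies it.\<close>
  have "is_arg_min (\<lambda>u. wnorm f (u - v)) (\<lambda>u. u \<in> U) u"
    using u closest_point_le[OF cl, of _ "wscale f v"]
    by (force simp: is_arg_min_linorder wnorm_diff_eq_dist[OF f] dist_commute)
  then have "is_arg_min (\<lambda>u. wnorm f (u - v)) (\<lambda>u. u \<in> U) (wproj f U v)"
    unfolding wproj_def arg_min_def by (rule someI)
  then show ?thesis
    using S cl by (intro closest_point_unique subspace_imp_convex)
      (auto simp: is_arg_min_linorder wnorm_diff_eq_dist[OF f] dist_commute)
qed

lemma wproj_nonexpansive:
  assumes f: "\<forall>s. 0 < f $ s" and U: "subspace U"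
  shows "wnorm f (wproj f U u - wproj f U v) \<le> wnorm f (u - v)"
proof -
  have S: "subspace (wscale f ` U)"
    using linear_wscale U by (rule linear_subspace_image)
  then have "wscale f ` U \<noteq> {}"
    using subspace_0 by blast
  with S show ?thesis
    unfolding wnorm_diff_eq_dist[OF f] wscale_wproj[OF f U]
    by (intro closest_point_lipschitz subspace_imp_convex closed_subspace)
qed

lemma wnorm_triangle_diff:
  assumes f: "\<forall>s. 0 < f $ s"
  shows "wnorm f (u - w) \<le> wnorm f (u - v) + wnorm f (v - w)"
  unfolding wnorm_diff_eq_dist[OF f] by (rule dist_triangle)

lemma subspace_feature_space: "subspace (feature_space \<Phi>)"
  unfolding feature_space_def
  by (intro linear_subspace_image matrix_vector_mul_linear subspace_UNIV)

section \<open>Contraction in the emphasis-weighted norm\<close>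

text \<open>A kernel vector satisfies \<open>x\<close> = \<gamma> P \<open>x\<close>. At an entry of
  largest modulus \<open>C\<close> this gives \<open>C\<close> \<le> \<gamma> \<open>C\<close>, so
  \<open>C\<close> cannot be positive.\<close>

lemma invertible_discounted:
  fixes M :: "('s::finite, 'a) mdp"
  assumes \<gamma>: "0 \<le> discount M" "discount M < 1"
  shows "invertible (mat 1 - discount M *\<^sub>R trans_matrix M \<pi>)"
  unfolding invertible_left_inverse matrix_left_invertible_ker
proof (intro allI impI)
  fix x :: "real ^ 's"
  assume "(mat 1 - discount M *\<^sub>R trans_matrix M \<pi>) *v x = 0"
  then have x: "x = discount M *\<^sub>R (trans_matrix M \<pi> *v x)"
    by (simp add: matrix_vector_mult_diff_rdistrib scaleR_matrix_vector_assoc)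
  define C where "C = Max (range (\<lambda>s. \<bar>x $ s\<bar>))"
  have C: "\<bar>x $ s\<bar> \<le> C" for s
    by (simp add: C_def)
  have "C \<in> range (\<lambda>s. \<bar>x $ s\<bar>)"
    unfolding C_def by (rule Max_in) auto
  then obtain s where "C = \<bar>x $ s\<bar>" by blast
  also have "\<dots> = discount M * \<bar>(trans_matrix M \<pi> *v x) $ s\<bar>"
    using \<gamma>(1) by (subst x) (simp add: abs_mult)
  also have "\<dots> \<le> discount M * C"
    using C \<gamma>(1) by (intro mult_left_mono trans_matrix_mult_bound)
  finally have "(1 - discount M) * C \<le> 0"
    by (simp add: algebra_simps)
  with \<gamma>(2) have "C \<le> 0"
    by (simp add: mult_le_0_iff)
  with C have "\<bar>x $ s\<bar> \<le> 0" for s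
    by (meson order_trans)
  then show "x = 0"
    by (simp add: vec_eq_iff)
qed

text \<open>The defining equation of the emphasis multiplied from the right by I - \<gamma> P.
  Invertibility is what makes \<open>matrix_inv\<close> a true inverse here.\<close>

lemma emphasis_balance:
  fixes M :: "('s::finite, 'a) mdp"
  assumes "0 \<le> discount M" "discount M < 1"
  shows "discount M *\<^sub>R (emphasis M \<pi> d v* trans_matrix M \<pi>) = emphasis M \<pi> d - d"
proof -
  let ?B = "mat 1 - discount M *\<^sub>R trans_matrix M \<pi>"
  have "matrix_inv ?B ** ?B = mat 1"
    using someI_ex[OF invertible_discounted[OF assms, unfolded invertible_def]]
    unfolding matrix_inv_def by blast
  then have "emphasis M \<pi> d v* ?B = d"
    by (simp add: emphasis_def vector_matrix_mul_assoc)
  then have "emphasis M \<pi> d - emphasis M \<pi> d v* (discount M *\<^sub>R trans_matrix M \<pi>) = d"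
    by (simp add: vector_matrix_mult_diff_rdistrib)
  moreover have "emphasis M \<pi> d v* (discount M *\<^sub>R trans_matrix M \<pi>) =
      discount M *\<^sub>R (emphasis M \<pi> d v* trans_matrix M \<pi>)"
    by (simp add: vector_matrix_mult_def vec_eq_iff sum_distrib_left mult_ac)
  ultimately show ?thesis
    by (simp add: algebra_simps)
qed

text \<open>Jensen's inequality for the square, proved as nonnegativity of the variance of
  \<open>v\<close> under row \<open>s\<close>, whose mean is \<open>m\<close>.\<close>

lemma trans_matrix_mult_square:
  fixes M :: "('s::finite, 'a) mdp"
  shows "((trans_matrix M \<pi> *v v) $ s)\<^sup>2 \<le> (trans_matrix M \<pi> *v (\<chi> s. (v $ s)\<^sup>2)) $ s"
proof -
  let ?p = "\<lambda>s'. trans_matrix M \<pi> $ s $ s'"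
  define m where "m = (\<Sum>s'\<in>UNIV. ?p s' * v $ s')"
  have "0 \<le> (\<Sum>s'\<in>UNIV. ?p s' * (v $ s' - m)\<^sup>2)"
    by (intro sum_nonneg mult_nonneg_nonneg trans_matrix_nonneg) simp
  also have "\<dots> = (\<Sum>s'\<in>UNIV. ?p s' * (v $ s')\<^sup>2 - 2 * m * (?p s' * v $ s') + m\<^sup>2 * ?p s')"
    by (intro sum.cong) (simp_all add: power2_eq_square algebra_simps)
  also have "\<dots> = (\<Sum>s'\<in>UNIV. ?p s' * (v $ s')\<^sup>2) - 2 * m * m + m\<^sup>2 * 1"
    unfolding sum.distrib sum_subtractf sum_distrib_left[symmetric] trans_matrix_row_sum
    by (simp add: m_def)
  finally show ?thesis
    by (simp add: matrix_vector_mult_def m_def[symmetric] power2_eq_square)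
qed

text \<open>Squaring produces two factors \<gamma>. One turns \<open>f v* P\<close> into
  \<open>f - d\<close> by the balance equation; the other stays and appears under the root.\<close>

lemma emphasis_contraction:
  fixes M :: "('s::finite, 'a) mdp"
  assumes \<gamma>: "0 \<le> discount M" "discount M < 1"
    and f_def: "f = emphasis M \<pi> d" and f: "\<forall>s. 0 < f $ s"
    and \<kappa>: "\<And>s. \<kappa> * f $ s \<le> d $ s"
  shows "wnorm f (discount M *\<^sub>R (trans_matrix M \<pi> *v v)) \<le>
    sqrt (discount M * (1 - \<kappa>)) * wnorm f v"
proof -
  let ?P = "trans_matrix M \<pi>" and ?\<gamma> = "discount M"
  define q :: "real ^ 's" where "q = (\<chi> s. (v $ s)\<^sup>2)"
  have "(\<Sum>s\<in>UNIV. f $ s * ((?\<gamma> *\<^sub>R (?P *v v)) $ s)\<^sup>2) =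
      ?\<gamma>\<^sup>2 * (\<Sum>s\<in>UNIV. f $ s * ((?P *v v) $ s)\<^sup>2)"
    by (simp add: sum_distrib_left power_mult_distrib mult_ac)
  also have "\<dots> \<le> ?\<gamma>\<^sup>2 * (\<Sum>s\<in>UNIV. f $ s * (?P *v q) $ s)"
    unfolding q_def using f
    by (intro mult_left_mono sum_mono trans_matrix_mult_square) (auto intro: less_imp_le)
  \<comment> \<open>The matrix moves from the squared vector \<open>q\<close> to the weight
    \<open>f\<close>, so that the balance equation applies.\<close>
  also have "\<dots> = ?\<gamma> * ((?\<gamma> *\<^sub>R (f v* ?P)) \<bullet> q)"
    by (simp add: dot_lmul_matrix power2_eq_square) (simp add: inner_vec_def)
  also have "?\<gamma> *\<^sub>R (f v* ?P) = f - d"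
    unfolding f_def by (rule emphasis_balance[OF \<gamma>])
  also have "?\<gamma> * ((f - d) \<bullet> q) \<le> ?\<gamma> * ((1 - \<kappa>) * (\<Sum>s\<in>UNIV. f $ s * (v $ s)\<^sup>2))"
  proof (intro mult_left_mono \<gamma>(1))
    \<comment> \<open>The bound on \<open>\<kappa>\<close> says \<open>f - d\<close> \<le> (1 -
      \<kappa>) \<open>f\<close> entrywise.\<close>
    have "(f $ s - d $ s) * (v $ s)\<^sup>2 \<le> (1 - \<kappa>) * (f $ s * (v $ s)\<^sup>2)" for s
      using mult_right_mono[of "f $ s - d $ s" "(1 - \<kappa>) * f $ s" "(v $ s)\<^sup>2"] \<kappa>[of s]
      by (simp add: algebra_simps)
    then show "(f - d) \<bullet> q \<le> (1 - \<kappa>) * (\<Sum>s\<in>UNIV. f $ s * (v $ s)\<^sup>2)"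
      by (simp add: inner_vec_def q_def sum_distrib_left sum_mono)
  qed
  finally show ?thesis
    unfolding wnorm_def real_sqrt_mult[symmetric] by (simp add: mult.assoc)
qed

theorem corollary1:
  fixes M :: "('s::finite, 'a) mdp"
    and \<pi> \<mu> :: "('s, 'a) policy"
    and d f :: "real ^ 's"
    and \<phi> :: "'s \<Rightarrow> real ^ 'n"
    and \<Phi> :: "real ^ 's ^ 'n"
    and \<theta> :: "real ^ 'n"
    and \<kappa> :: real
  assumes "0 \<le> discount M" and "discount M < 1"
    and "reward_summable M \<pi>"
    and "ratios_well_defined M \<pi> \<mu>"
    and "stationary M \<mu> d"
    and "f = emphasis M \<pi> d"
    and "\<forall>s. 0 < f $ s"
    and "\<kappa> = (MIN s. d $ s / f $ s)"
    and "\<Phi> = feature_matrix \<phi>"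
    and "transpose \<Phi> *v \<theta> = wproj f (feature_space \<Phi>) (bellman M \<pi> (transpose \<Phi> *v \<theta>))"
  shows "wnorm f (transpose \<Phi> *v \<theta> - value_fun M \<pi>)
    \<le> 1 / (1 - sqrt (discount M * (1 - \<kappa>)))
        * wnorm f (wproj f (feature_space \<Phi>) (value_fun M \<pi>) - value_fun M \<pi>)"
proof -
  let ?V = "value_fun M \<pi>" and ?v = "transpose \<Phi> *v \<theta>"
  let ?\<Pi> = "wproj f (feature_space \<Phi>)" and ?\<beta> = "sqrt (discount M * (1 - \<kappa>))"
  note \<gamma> = assms(1,2) and f = assms(7)
  have f0: "0 < f $ s" for s
    using f by blast
  have \<kappa>_le: "\<kappa> \<le> d $ s / f $ s" for s
    unfolding assms(8) by (rule Min_le) auto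
  then have \<kappa>: "\<kappa> * f $ s \<le> d $ s" for s
    using f0[of s] by (simp add: le_divide_eq)
  \<comment> \<open>The minimum is attained, so it inherits nonnegativity from the ratios; this
    yields \<open>?\<beta>\<close> < 1.\<close>
  have "\<kappa> \<in> range (\<lambda>s. d $ s / f $ s)"
    unfolding assms(8) by (rule Min_in) auto
  then have "0 \<le> \<kappa>"
    using assms(5) f0 by (auto simp: stationary_def less_imp_le)
  then have "discount M * (1 - \<kappa>) \<le> discount M * 1"
    using \<gamma>(1) by (intro mult_left_mono) auto
  then have \<beta>: "?\<beta> < 1"
    using \<gamma>(2) by simp
  have "bellman M \<pi> ?v - bellman M \<pi> ?V = discount M *\<^sub>R (trans_matrix M \<pi> *v (?v - ?V))"
    by (simp add: bellman_def matrix_vector_mult_diff_distrib scaleR_diff_right)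
  then have TV: "bellman M \<pi> ?v - ?V = discount M *\<^sub>R (trans_matrix M \<pi> *v (?v - ?V))"
    by (simp add: bellman_value_fun[OF assms(1-3)])
  \<comment> \<open>Splitting at the projected value function leaves a difference of two
    projections, since \<open>?v\<close> is a projected Bellman image; nonexpansiveness and
    contraction bound it by \<open>?\<beta>\<close> times the left side, which is then
    absorbed.\<close>
  have "wnorm f (?v - ?V) \<le> wnorm f (?v - ?\<Pi> ?V) + wnorm f (?\<Pi> ?V - ?V)"
    by (rule wnorm_triangle_diff[OF f])
  also have "wnorm f (?v - ?\<Pi> ?V) = wnorm f (?\<Pi> (bellman M \<pi> ?v) - ?\<Pi> ?V)"
    using assms(10) by simp
  also have "\<dots> \<le> wnorm f (bellman M \<pi> ?v - ?V)"
    by (rule wproj_nonexpansive[OF f subspace_feature_space])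
  also have "\<dots> \<le> ?\<beta> * wnorm f (?v - ?V)"
    unfolding TV by (rule emphasis_contraction[OF \<gamma> assms(6) f \<kappa>])
  finally have "(1 - ?\<beta>) * wnorm f (?v - ?V) \<le> wnorm f (?\<Pi> ?V - ?V)"
    by (simp add: algebra_simps)
  with \<beta> show ?thesis
    by (simp add: pos_le_divide_eq mult.commute)
qed

end
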